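(* Let $n\ge1$ be an integer, let $c_1,\dots,c_n\in\mathbb{R}$, and let $X_1,\dots,X_n$ be independent random variables such that, for each $k=1,\dots,n$, $X_k\sim\mathit{TQG}(\mu_k,\sigma_k,q_k)$ with $\mu_k\in\mathbb{R}$, $\sigma_k>0$, $q_k<3$, so that $X_k$ has characteristic function $\operatorname{cf}_{X_k}(t)=\operatorname{cf}_{\mathit{TQG}(\mu_k,\sigma_k,q_k)}(t)$. Let $Y=\sum_{k=1}^n c_kX_k$. Then the characteristic function of $Y$ is, for all $t\in\mathbb{R}$, $$\operatorname{cf}_Y(t)=\prod_{k=1}^n\operatorname{cf}_{X_k}(c_kt)=\prod_{k=1}^n\operatorname{cf}_{\mathit{TQG}(\mu_k,\sigma_k,q_k)}(c_kt).$$
   Context: The characteristic function of a real random variable $X$ (or of its distribution) is $\operatorname{cf}_X(t)=\mathbb{E}[e^{\mathrm{i}tX}]$, $t\in\mathbb{R}$, where $\mathrm{i}=\sqrt{-1}$. For $\mu\in\mathbb{R}$ (location), $\sigma>0$ (scale) and $q<3$ (shape), the Tsallis $q$-Gaussian distribution $\mathit{TQG}(\mu,\sigma,q)$ is the probability distribution on $\mathbb{R}$ with density with respect to Lebesgue measure $$f(x)=C_{q,\sigma}\left[1-(1-q)\frac12\left(\frac{x-\mu}{\sigma}\right)^2\right]_+^{\frac{1}{1-q}}\qquad(q\neq1),$$ where $[z]_+=\max(0,z)$ and $C_{q,\sigma}>0$ is the normalizing constant. For $q=1$, $\mathit{TQG}(\mu,\sigma,1)$ is the normal distribution $N(\mu,\sigma^2)$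 with mean $\mu$ and variance $\sigma^2$. The function $\operatorname{cf}_{\mathit{TQG}(\mu,\sigma,q)}$ denotes the characteristic function of $\mathit{TQG}(\mu,\sigma,q)$. *)

theory Defs
  imports "HOL-Probability.Probability"
begin

definition tqg_kernel :: "real \<Rightarrow> real \<Rightarrow> real" where
  "tqg_kernel q z = (max 0 (1 - (1 - q) * (1 / 2) * z\<^sup>2)) powr (1 / (1 - q))"

text \<open>The normalizing constant does not depend on the location. It is genuinely positive, and
  normalizes the density, by \<open>tqg_const_pos\<close> and \<open>prob_space_TQG\<close> below; the point to be
  checked is that the integral is not \<open>0\<close> by the convention for non-integrable functions.\<close>

definition tqg_const :: "real \<Rightarrow> real \<Rightarrow> real" where
  "tqg_const q \<sigma> = 1 / (LINT x|lborel. tqg_kernel q (x / \<sigma>))"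

definition tqg_density :: "real \<Rightarrow> real \<Rightarrow> real \<Rightarrow> real \<Rightarrow> real" where
  "tqg_density \<mu> \<sigma> q x =
     (if q = 1 then normal_density \<mu> \<sigma> x
      else tqg_const q \<sigma> * tqg_kernel q ((x - \<mu>) / \<sigma>))"

definition TQG :: "real \<Rightarrow> real \<Rightarrow> real \<Rightarrow> real measure" where
  "TQG \<mu> \<sigma> q = density lborel (\<lambda>x. ennreal (tqg_density \<mu> \<sigma> q x))"

text \<open>Characteristic function of a random variable; the library constant \<^const>\<open>char\<close> is
  that of a distribution.\<close>

definition cf :: "'a measure \<Rightarrow> ('a \<Rightarrow> real) \<Rightarrow> real \<Rightarrow> complex" where
  "cf M X t = (CLINT \<omega>|M. iexp (t * X \<omega>))"

lemma cf_eq_char_distr: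
  assumes "X \<in> borel_measurable M"
  shows "cf M X t = char (distr M borel X) t"
  using assms unfolding cf_def char_def by (subst integral_distr) auto

lemma tqg_kernel_measurable [measurable]: "tqg_kernel q \<in> borel_measurable borel"
  unfolding tqg_kernel_def by measurable

lemma tqg_kernel_nonneg: "tqg_kernel q z \<ge> 0"
  by (simp add: tqg_kernel_def)

lemma integrable_powr_tail:
  fixes e :: real
  assumes "e < -1"
  shows "integrable lborel (\<lambda>x. indicator {1..} x * x powr e)"
proof (rule integrableI_nonneg)
  have "(\<integral>\<^sup>+x. ennreal (indicator {1..} x * x powr e) \<partial>lborel)
          = ennreal (- (1 powr (e + 1)) / (e + 1))"
    using nn_integral_has_integral_lebesgue[OF _ has_integral_powr_to_inf[OF assms, of 1]]
    by simp
  then show "(\<integral>\<^sup>+x. ennreal (indicator {1..} x * x powr e) \<partial>lborel) < \<infinity>" by simp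
qed auto

lemma integrable_tqg_kernel:
  assumes "q < 3" "q \<noteq> 1"
  shows "integrable lborel (tqg_kernel q)"
proof (cases "q < 1")
  case True
  define r where "r = 1 + 2 / (1 - q)"
  have "integrable lborel (\<lambda>z. indicator {-r..r} z :: real)"
    by (intro integrable_real_indicator) (auto simp: emeasure_lborel_Icc_eq)
  then show ?thesis
  proof (rule Bochner_Integration.integrable_bound)
    show "AE z in lborel. norm (tqg_kernel q z) \<le> norm (indicator {-r..r} z :: real)"
    proof (intro AE_I2)
      fix z :: real
      show "norm (tqg_kernel q z) \<le> norm (indicator {-r..r} z :: real)"
      proof (cases "z \<in> {-r..r}")
        case True
        have "max 0 (1 - (1 - q) * (1 / 2) * z\<^sup>2) \<le> 1" using \<open>q < 1\<close> by simp
        then have "tqg_kernel q z \<le> 1"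
          unfolding tqg_kernel_def using \<open>q < 1\<close> by (intro powr_le1) auto
        then show ?thesis using True tqg_kernel_nonneg[of q z] by simp
      next
        case False
        then have "\<bar>z\<bar> > r" by auto
        moreover have "r > 1" using \<open>q < 1\<close> by (simp add: r_def)
        ultimately have "\<bar>z\<bar> * \<bar>z\<bar> > r * 1"
          by (intro mult_strict_mono) auto
        then have "z\<^sup>2 > r" by (simp add: power2_eq_square)
        then have "(1 - q) * z\<^sup>2 > (1 - q) * r"
          using \<open>q < 1\<close> by simp
        moreover have "(1 - q) * r = (1 - q) + 2"
          using \<open>q < 1\<close> by (simp add: r_def field_simps)
        ultimately have "max 0 (1 - (1 - q) * (1 / 2) * z\<^sup>2) = 0" using \<open>q < 1\<close> by simp
        then show ?thesis by (simp add: tqg_kernel_def)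
      qed
    qed
  qed auto
next
  case False
  with assms have q: "1 < q" "q < 3" by auto
  define a where "a = (q - 1) / 2"
  define p where "p = 1 / (q - 1)"
  have a: "a > 0" and p: "p > 1 / 2" using q by (auto simp: a_def p_def field_simps)
  have ker: "tqg_kernel q z = (1 + a * z\<^sup>2) powr (- p)" for z
  proof -
    have "1 - (1 - q) * (1 / 2) * z\<^sup>2 = 1 + a * z\<^sup>2" by (simp add: a_def field_simps)
    moreover have "1 + a * z\<^sup>2 \<ge> 0" using a by simp
    moreover have "1 / (1 - q) = - p" using q by (simp add: p_def field_simps)
    ultimately show ?thesis by (simp only: tqg_kernel_def max_absorb2)
  qed
  define H where "H x = indicator {1..} x * x powr (- 2 * p)" for x :: real
  have H: "integrable lborel H"
    unfolding H_def using p by (intro integrable_powr_tail) auto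
  have H': "integrable lborel (\<lambda>x. H (- x))"
    using lborel_integrable_real_affine[OF H, of "-1" 0] by simp
  have H0: "H x \<ge> 0" for x by (simp add: H_def)
  have tail: "tqg_kernel q z \<le> a powr (- p) * \<bar>z\<bar> powr (- 2 * p)" if "\<bar>z\<bar> \<ge> 1" for z
  proof -
    have z: "\<bar>z\<bar> > 0" using that by simp
    then have "z\<^sup>2 > 0" by simp
    then have "tqg_kernel q z \<le> (a * z\<^sup>2) powr (- p)"
      unfolding ker using a p by (intro powr_mono2') auto
    also have "\<dots> = a powr (- p) * (z\<^sup>2) powr (- p)"
      using a by (simp add: powr_mult)
    also have "z\<^sup>2 = \<bar>z\<bar> powr 2" using z by simp
    also have "(\<bar>z\<bar> powr 2) powr (- p) = \<bar>z\<bar> powr (- 2 * p)"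
      by (simp only: powr_powr) simp
    finally show ?thesis .
  qed
  have "integrable lborel (\<lambda>z. indicator {-1..1::real} z :: real)"
    by (intro integrable_real_indicator) (auto simp: emeasure_lborel_Icc_eq)
  then have "integrable lborel
      (\<lambda>z. indicator {-1..1} z + a powr (- p) * (H z + H (- z)))"
    using H H' by simp
  then show ?thesis
  proof (rule Bochner_Integration.integrable_bound)
    show "AE z in lborel. norm (tqg_kernel q z)
        \<le> norm (indicator {-1..1} z + a powr (- p) * (H z + H (- z)))"
    proof (intro AE_I2)
      fix z :: real
      have nn: "a powr (- p) * (H z + H (- z)) \<ge> 0" using H0 by simp
      have "tqg_kernel q z \<le> indicator {-1..1} z + a powr (- p) * (H z + H (- z))"
      proof (cases "\<bar>z\<bar> < 1")
        case True
        have "tqg_kernel q z \<le> 1 powr (- p)"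
          unfolding ker using a p by (intro powr_mono2') auto
        then show ?thesis using True nn by (auto simp: indicator_def)
      next
        case False
        have "\<bar>z\<bar> powr (- 2 * p) \<le> H z + H (- z)"
          using False H0[of z] H0[of "- z"] by (auto simp: H_def indicator_def abs_if)
        then have "a powr (- p) * \<bar>z\<bar> powr (- 2 * p) \<le> a powr (- p) * (H z + H (- z))"
          by (intro mult_left_mono) auto
        then show ?thesis using tail[of z] False
          by (auto simp: indicator_def)
      qed
      then show "norm (tqg_kernel q z)
          \<le> norm (indicator {-1..1} z + a powr (- p) * (H z + H (- z)))"
        using tqg_kernel_nonneg[of q z] nn by simp
    qed
  qed auto
qed

lemma integral_tqg_kernel_pos:
  assumes "q < 3" "q \<noteq> 1"
  shows "(LINT x|lborel. tqg_kernel q x) > 0"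
proof -
  define d where "d = 1 / (1 + \<bar>1 - q\<bar>)"
  have d: "d > 0" "d \<le> 1" by (auto simp: d_def field_simps)
  have pos: "tqg_kernel q z \<noteq> 0" if "z \<in> {-d<..<d}" for z
  proof -
    have "\<bar>z\<bar> * \<bar>z\<bar> \<le> d * 1" using that d by (intro mult_mono) auto
    then have "z\<^sup>2 \<le> d" by (simp add: power2_eq_square)
    then have "\<bar>1 - q\<bar> * z\<^sup>2 \<le> \<bar>1 - q\<bar> * d" by (intro mult_left_mono) auto
    moreover have "\<bar>1 - q\<bar> * d < 1" by (simp add: d_def field_simps)
    moreover have "(1 - q) * z\<^sup>2 \<le> \<bar>1 - q\<bar> * z\<^sup>2" by (intro mult_right_mono) auto
    ultimately have "1 - (1 - q) * (1 / 2) * z\<^sup>2 > 0" by simp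
    then show ?thesis by (simp add: tqg_kernel_def)
  qed
  have "(LINT x|lborel. tqg_kernel q x) \<noteq> 0"
  proof
    assume "(LINT x|lborel. tqg_kernel q x) = 0"
    then have "AE x in lborel. tqg_kernel q x = 0"
      using integral_nonneg_eq_0_iff_AE[OF integrable_tqg_kernel[OF assms]]
      by (simp add: tqg_kernel_nonneg)
    then have "AE x in lborel. x \<notin> {-d<..<d}"
      using pos by (auto elim!: eventually_mono)
    then have "emeasure lborel {-d<..<d} = 0"
      by (subst (asm) AE_iff_measurable[of "{-d<..<d}"]) auto
    then show False using d by simp
  qed
  moreover have "(LINT x|lborel. tqg_kernel q x) \<ge> 0"
    by (intro Bochner_Integration.integral_nonneg tqg_kernel_nonneg)
  ultimately show ?thesis by simp
qed

lemma tqg_kernel_affine: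
  assumes "\<sigma> > 0" "q < 3" "q \<noteq> 1"
  shows "integrable lborel (\<lambda>x. tqg_kernel q ((x - \<mu>) / \<sigma>))"
    and "(LINT x|lborel. tqg_kernel q ((x - \<mu>) / \<sigma>)) = \<sigma> * (LINT x|lborel. tqg_kernel q x)"
proof -
  have eq: "(x - \<mu>) / \<sigma> = - \<mu> / \<sigma> + (1 / \<sigma>) * x" for x
    using assms by (simp add: field_simps)
  show "integrable lborel (\<lambda>x. tqg_kernel q ((x - \<mu>) / \<sigma>))"
    unfolding eq using assms
    by (intro lborel_integrable_real_affine integrable_tqg_kernel) auto
  show "(LINT x|lborel. tqg_kernel q ((x - \<mu>) / \<sigma>)) = \<sigma> * (LINT x|lborel. tqg_kernel q x)"
    unfolding eq using assms
      lborel_integral_real_affine[of "1 / \<sigma>" "tqg_kernel q" "- \<mu> / \<sigma>"]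
    by (simp add: field_simps)
qed

lemma tqg_const_pos:
  assumes "\<sigma> > 0" "q < 3" "q \<noteq> 1"
  shows "tqg_const q \<sigma> > 0"
  using tqg_kernel_affine(2)[OF assms, of 0] integral_tqg_kernel_pos[of q] assms
  by (simp add: tqg_const_def)

lemma prob_space_TQG:
  assumes "\<sigma> > 0" "q < 3"
  shows "prob_space (TQG \<mu> \<sigma> q)"
proof (cases "q = 1")
  case True
  then show ?thesis
    using prob_space_normal_density[OF assms(1)] by (simp add: TQG_def tqg_density_def)
next
  case False
  note q = assms False
  have I: "integrable lborel (tqg_density \<mu> \<sigma> q)"
    unfolding tqg_density_def using tqg_kernel_affine(1)[OF q, of \<mu>] False by simp
  have nn: "tqg_density \<mu> \<sigma> q x \<ge> 0" for x
    using tqg_const_pos[OF q] False by (simp add: tqg_density_def tqg_kernel_nonneg)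
  have "(LINT x|lborel. tqg_density \<mu> \<sigma> q x) = 1"
    unfolding tqg_density_def tqg_const_def
    using tqg_kernel_affine(2)[OF q, of \<mu>] tqg_kernel_affine(2)[OF q, of 0]
      integral_tqg_kernel_pos[of q] q
    by simp
  then have "(\<integral>\<^sup>+x. ennreal (tqg_density \<mu> \<sigma> q x) \<partial>lborel) = 1"
    using nn_integral_eq_integral[OF I] nn by simp
  then show ?thesis
    using I by (intro prob_spaceI) (simp add: TQG_def emeasure_density)
qed

end

theory Submission
  imports Defs
begin

text \<open>Since \<open>iexp\<close> turns sums into products, and the expectation of a product of
  independent factors is the product of their expectations, the characteristic function of a sum of
  independent variables factorises (\<open>char_distr_sum\<close>). A coefficient \<open>c k\<close>
  moves from the variable to the argument. The q-Gaussian law enters only at the end, because a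
  characteristic function depends only on the law of its variable; \<open>cf_eq_char_distr\<close>
  translates between the two views.\<close>

theorem corollary1:
  fixes M :: "'a measure" and X :: "nat \<Rightarrow> 'a \<Rightarrow> real" and Y :: "'a \<Rightarrow> real"
    and c \<mu> \<sigma> q :: "nat \<Rightarrow> real" and n :: nat
  assumes "prob_space M"
    and "n \<ge> 1"
    and "prob_space.indep_vars M (\<lambda>_. borel) X {1..n}"
    and "\<And>k. k \<in> {1..n} \<Longrightarrow> \<sigma> k > 0"
    and "\<And>k. k \<in> {1..n} \<Longrightarrow> q k < 3"
    and "\<And>k. k \<in> {1..n} \<Longrightarrow> distr M borel (X k) = TQG (\<mu> k) (\<sigma> k) (q k)"
    and "Y = (\<lambda>\<omega>. \<Sum>k=1..n. c k * X k \<omega>)"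
  shows "\<forall>t::real. cf M Y t = (\<Prod>k=1..n. cf M (X k) (c k * t))
    \<and> (\<Prod>k=1..n. cf M (X k) (c k * t)) = (\<Prod>k=1..n. char (TQG (\<mu> k) (\<sigma> k) (q k)) (c k * t))"
proof (intro allI conjI)
  fix t :: real
  interpret prob_space M by fact
  have X: "X k \<in> borel_measurable M" if "k \<in> {1..n}" for k
    using assms(3) that by (auto simp: indep_vars_def)
  \<comment> \<open>Applying a Borel map to each variable separately preserves independence.\<close>
  have ind: "indep_vars (\<lambda>_. borel) (\<lambda>k \<omega>. c k * X k \<omega>) {1..n}"
    using indep_vars_compose2[OF assms(3), of "\<lambda>k x. c k * x" "\<lambda>_. borel"] by simp
  have "cf M Y t = char (distr M borel (\<lambda>\<omega>. \<Sum>k\<in>{1..n}. c k * X k \<omega>)) t"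
    unfolding assms(7) using X by (intro cf_eq_char_distr) auto
  also have "\<dots> = (\<Prod>k=1..n. char (distr M borel (\<lambda>\<omega>. c k * X k \<omega>)) t)"
    by (rule char_distr_sum[OF ind])
  also have "\<dots> = (\<Prod>k=1..n. cf M (\<lambda>\<omega>. c k * X k \<omega>) t)"
    using X by (intro prod.cong refl cf_eq_char_distr[symmetric]) auto
  \<comment> \<open>Both exponents are the same product \<open>t * c k * X k \<omega>\<close>, so
    \<open>c k = 0\<close> needs no separate case.\<close>
  also have "\<dots> = (\<Prod>k=1..n. cf M (X k) (c k * t))"
    by (simp add: cf_def mult_ac)
  finally show "cf M Y t = (\<Prod>k=1..n. cf M (X k) (c k * t))" .
  \<comment> \<open>Factor by factor, the law of \<open>X k\<close> is replaced by the given
    \<open>TQG\<close> measure.\<close>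
  show "(\<Prod>k=1..n. cf M (X k) (c k * t))
      = (\<Prod>k=1..n. char (TQG (\<mu> k) (\<sigma> k) (q k)) (c k * t))"
    using X assms(6) by (intro prod.cong refl) (simp add: cf_eq_char_distr)
qed

end
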